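(* Let $\mathcal{P}$ be a regular $3$-polytope with $E$ edges and $V$ vertices inscribed in a sphere of radius $1$ in $\mathbb{R}^3$. Let $\nu$ be the number of vertices incident to any edge of $\mathcal{P}$ and $\varepsilon$ the number of edges incident to any vertex of $\mathcal{P}$. Let $c_1,\dots,c_N$ be the lengths of all $N$ chords of $\mathcal{P}$ (one entry for each chord) and let $d_1,\dots,d_k$ be the distinct chord lengths of $\mathcal{P}$. Let $a,b$ be positive integers such that $\prod_{i=1}^{N}c_i^2=\nu^{a}/\varepsilon^{b}$, $E$ divides $b$, and: $a\equiv 0\pmod E$ and $a\equiv E\pmod V$ if $\mathcal{P}$ is a tetrahedron; $a\equiv V\pmod E$ and $a\equiv E\pmod V$ if $\mathcal{P}$ is an octahedron or a cube; $a\equiv V\pmod E$ and $a\equiv 0\pmod V$ if $\mathcal{P}$ is an icosahedron or a dodecahedron. Then there exist integers $c,d$ such that $$\prod_{i=1}^{k}d_i^2=\frac{\nu^{c}}{\varepsilon^{d}}$$ and: 1. if $\mathcal{P}$ is a tetrahedron, then $b=dE$; 2. if $\mathcal{P}$ is a cube or an icosahedron, then $b=dE$; 3. if $\mathcal{P}$ is an octahedron or a dodecahedron, then $a=cVm$, where $m=1$ for the octahedron and $m=2$ for the dodecahedron. In addition, writing $$\varepsilon'=\frac{E}{(E,V)}=\frac{[E,V]}{V},$$ where $(E,V)$ is the greatest common divisor and $[E,V]$ the least common multiple of $E$ and $V$, there exist integers $c',d'$ (possibly different from $c,d$) such that $$\prod_{i=1}^{k}d_i^2=\frac{\nu^{c'}}{(\varepsilon')^{d'}}$$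 and: $b=d'E$ if $\mathcal{P}$ is a tetrahedron, a cube or an icosahedron; $a=c'Vm$ if $\mathcal{P}$ is an octahedron or a dodecahedron, where $m=1$ for the octahedron and $m=2$ for the dodecahedron.
   Context: A regular $3$-polytope is one of the five regular convex polyhedra (tetrahedron, octahedron, cube, icosahedron, dodecahedron, all regular). It is inscribed in a sphere if all its vertices lie on the sphere. A chord is a line segment whose endpoints are two distinct vertices of the polytope (so chords are all edges and all diagonals). *)

theory Defs
  imports "HOL-Analysis.Analysis" "HOL-Number_Theory.Cong"
begin

definition similar_to :: "'a::euclidean_space set \<Rightarrow> 'a set \<Rightarrow> bool" where
  "similar_to P Q \<longleftrightarrow>
     (\<exists>r f t. 0 < r \<and> orthogonal_transformation f \<and> P = (\<lambda>x. t + r *\<^sub>R f x) ` Q)"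

definition golden_ratio :: real where
  "golden_ratio = (1 + sqrt 5) / 2"

text \<open>
  Each of the five regular convex polyhedra is determined up to similarity, so each kind is
  given as the class of all similar copies (any centre, size and orientation) of the convex
  hull of the usual Cartesian coordinates of its vertices.
\<close>

definition tetrahedron :: "(real ^ 3) set \<Rightarrow> bool" where
  "tetrahedron P \<longleftrightarrow> similar_to P (convex hull
     {vector [1, 1, 1], vector [1, -1, -1], vector [-1, 1, -1], vector [-1, -1, 1]})"

definition octahedron :: "(real ^ 3) set \<Rightarrow> bool" where
  "octahedron P \<longleftrightarrow> similar_to P (convex hull
     {vector [1, 0, 0], vector [-1, 0, 0], vector [0, 1, 0], vector [0, -1, 0],
      vector [0, 0, 1], vector [0, 0, -1]})"

definition cube :: "(real ^ 3) set \<Rightarrow> bool" where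
  "cube P \<longleftrightarrow> similar_to P (convex hull
     {vector [x, y, z] | x y z. x \<in> {-1, 1} \<and> y \<in> {-1, 1} \<and> z \<in> {-1, 1}})"

text \<open>
  Icosahedron: the cyclic permutations of \<open>(0, \<plusminus>1, \<plusminus>\<phi>)\<close>, with \<open>\<phi>\<close> the golden ratio.
  Dodecahedron: the vertices \<open>(\<plusminus>1, \<plusminus>1, \<plusminus>1)\<close> together with the cyclic permutations of
  \<open>(0, \<plusminus>1/\<phi>, \<plusminus>\<phi>)\<close>.
\<close>

definition icosahedron :: "(real ^ 3) set \<Rightarrow> bool" where
  "icosahedron P \<longleftrightarrow> similar_to P (convex hull
     ({vector [0, s, t * golden_ratio] | s t. s \<in> {-1, 1} \<and> t \<in> {-1, 1}} \<union>
      {vector [t * golden_ratio, 0, s] | s t. s \<in> {-1, 1} \<and> t \<in> {-1, 1}} \<union>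
      {vector [s, t * golden_ratio, 0] | s t. s \<in> {-1, 1} \<and> t \<in> {-1, 1}}))"

definition dodecahedron :: "(real ^ 3) set \<Rightarrow> bool" where
  "dodecahedron P \<longleftrightarrow> similar_to P (convex hull
     ({vector [x, y, z] | x y z. x \<in> {-1, 1} \<and> y \<in> {-1, 1} \<and> z \<in> {-1, 1}} \<union>
      {vector [0, s / golden_ratio, t * golden_ratio] | s t. s \<in> {-1, 1} \<and> t \<in> {-1, 1}} \<union>
      {vector [t * golden_ratio, 0, s / golden_ratio] | s t. s \<in> {-1, 1} \<and> t \<in> {-1, 1}} \<union>
      {vector [s / golden_ratio, t * golden_ratio, 0] | s t. s \<in> {-1, 1} \<and> t \<in> {-1, 1}}))"

definition regular_3_polytope :: "(real ^ 3) set \<Rightarrow> bool" where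
  "regular_3_polytope P \<longleftrightarrow>
     tetrahedron P \<or> octahedron P \<or> cube P \<or> icosahedron P \<or> dodecahedron P"

definition vertices :: "'a::euclidean_space set \<Rightarrow> 'a set" where
  "vertices P = {v. v extreme_point_of P}"

definition edges :: "'a::euclidean_space set \<Rightarrow> 'a set set" where
  "edges P = {e. e edge_of P}"

definition inscribed_in_sphere :: "'a::euclidean_space set \<Rightarrow> real \<Rightarrow> bool" where
  "inscribed_in_sphere P r \<longleftrightarrow> (\<exists>z. vertices P \<subseteq> sphere z r)"

text \<open>
  Chords are unoriented segments, so each unordered pair of distinct vertices gives exactly
  one chord; the length of a segment is its diameter.
\<close>

definition chords :: "'a::euclidean_space set \<Rightarrow> 'a set set" where
  "chords P = {closed_segment u v | u v. u \<in> vertices P \<and> v \<in> vertices P \<and> u \<noteq> v}"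

definition chord_lengths :: "'a::euclidean_space set \<Rightarrow> real set" where
  "chord_lengths P = diameter ` chords P"

end

theory Submission
  imports Defs
begin

text \<open>
  For each solid the assertion comes down to knowing \<open>V\<close>, \<open>E\<close>, \<open>\<nu>\<close>, \<open>\<epsilon>\<close> and the two chord products. With
  circumradius 1 the products over all chords and over the distinct lengths are
  \<open>2^18 / 3^6\<close> and \<open>2^3 / 3\<close> (tetrahedron), \<open>2^18\<close> and \<open>2^3\<close> (octahedron), \<open>2^68 / 3^24\<close> and \<open>2^7 / 3^2\<close>
  (cube), \<open>2^132 / 5^30\<close> and \<open>2^6 / 5\<close> (icosahedron), \<open>2^440 / 3^180\<close> and \<open>2^11 / 3^4\<close>
  (dodecahedron). Always \<open>\<nu> = 2\<close>, and \<open>\<epsilon>\<close> is 3 or 5 except for the octahedron. So unique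
  factorization yields \<open>a\<close> and \<open>b\<close>, and the exponents \<open>c\<close> and \<open>d\<close> of the second product stand in the
  stated proportion to them. Moreover \<open>\<epsilon>' = \<epsilon>\<close>, so the same exponents serve again. For the octahedron
  \<open>\<epsilon> = 4\<close> and \<open>\<epsilon>' = 2\<close>: the product only gives \<open>a = 18 + 2 b\<close>, but \<open>b = 12 j\<close> for some \<open>j\<close>, and then
  \<open>c = c' = 3 + 4 j\<close>, \<open>d = 2 j\<close> and \<open>d' = 4 j\<close> represent \<open>2^3\<close>.

  The geometric part is to find the vertices and edges of the convex hull of the given points.
  They lie on a sphere, so each of them is a vertex. Two points at the least distance span an edge,
  since the sum of the squared distances to them is an affine function on the sphere that is
  smallest at exactly these two points (\<open>face_if_minimizes_sum_of_squares\<close>). Any other pair is not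
  an edge, because its segment is crossed by another diagonal, as in a parallelogram or in a regular
  pentagon (\<open>crossed_segment_not_face\<close>). After this (\<open>edges_hull\<close>) all required numbers depend only on
  the mutual distances of the vertices.

  The coordinates lie in the ring \<open>\<int>[\<phi>]\<close> of the golden ratio, where distances, their products and
  the crossings are computed exactly. The lemma \<open>golden_solid_metric_data\<close> carries the result
  over to every similar copy that is inscribed in a unit sphere.
\<close>

section \<open>Edges as closest pairs of vertices\<close>

lemma diameter_closed_segment_eq_dist:
  fixes u v :: "'a::euclidean_space"
  shows "diameter (closed_segment u v) = dist u v"
proof (rule antisym)
  show "diameter (closed_segment u v) \<le> dist u v"
  proof (rule diameter_le)
    fix x y assume x: "x \<in> closed_segment u v" and y: "y \<in> closed_segment u v"
    have "closed_segment u v \<subseteq> cball y (dist u v)"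
      using dist_in_closed_segment[OF y] by (intro closed_segment_subset) auto
    then show "norm (x - y) \<le> dist u v" using x by (auto simp: dist_norm norm_minus_commute)
  qed auto
  show "dist u v \<le> diameter (closed_segment u v)"
    by (rule diameter_bounded_bound) (auto simp: bounded_closed_segment)
qed

text \<open>
  A segment remembers its endpoints but not their order, so a symmetric set of ordered pairs
  covers its segments exactly twice. This lets all counts and products over edges and chords be
  taken over ordered pairs, one vertex at a time.
\<close>

lemma prod_segments_squared:
  fixes h :: "'a::euclidean_space set \<Rightarrow> 'b::comm_monoid_mult" and A :: "('a \<times> 'a) set"
  assumes "finite A" and sym: "\<And>u v. (u, v) \<in> A \<Longrightarrow> (v, u) \<in> A \<and> u \<noteq> v"
  shows "(\<Prod>(u, v)\<in>A. h (closed_segment u v))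
       = (\<Prod>s\<in>(\<lambda>(u, v). closed_segment u v) ` A. h s) ^ 2"
proof -
  let ?f = "\<lambda>(u, v). closed_segment u v :: 'a set"
  have "(\<Prod>(u, v)\<in>A. h (closed_segment u v)) = prod (\<lambda>p. h (?f p)) A"
    by (simp add: case_prod_beta)
  also have "\<dots> = (\<Prod>s\<in>?f ` A. prod (\<lambda>p. h (?f p)) {p \<in> A. ?f p = s})"
    using assms(1) by (intro prod.group[symmetric]) auto
  also have "\<dots> = (\<Prod>s\<in>?f ` A. h s ^ 2)"
  proof (rule prod.cong[OF refl])
    fix s assume "s \<in> ?f ` A"
    then obtain u v where uv: "(u, v) \<in> A" and s: "s = closed_segment u v" by auto
    have "{p \<in> A. ?f p = s} = {(u, v), (v, u)}"
      using uv sym[OF uv] unfolding s by (auto simp: doubleton_eq_iff closed_segment_commute)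
    then show "prod (\<lambda>p. h (?f p)) {p \<in> A. ?f p = s} = h s ^ 2"
      using sym[OF uv] by (simp add: s closed_segment_commute power2_eq_square)
  qed
  finally show ?thesis by (simp add: power2_eq_square prod.distrib)
qed

text \<open>
  A face that meets an open segment of \<open>P\<close> contains its endpoints. So if \<open>[x, y]\<close> were a face,
  it would contain \<open>u\<close>, and a vertex inside \<open>[x, y]\<close> can only be \<open>x\<close> or \<open>y\<close>.
\<close>

lemma crossed_segment_not_face:
  assumes xy: "x extreme_point_of P" "y extreme_point_of P"
    and uv: "u extreme_point_of P" "v \<in> P" "u \<notin> {x, y}"
    and cross: "open_segment x y \<inter> open_segment u v \<noteq> {}"
  shows "\<not> closed_segment x y face_of P"
proof
  assume f: "closed_segment x y face_of P"
  obtain p where p: "p \<in> open_segment x y" "p \<in> open_segment u v" using cross by auto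
  have "u \<in> closed_segment x y"
    using f uv p unfolding face_of_def extreme_point_of_def by (meson open_closed_segment)
  then have "u \<in> open_segment x y" using uv(3) by (auto simp: open_segment_def)
  then show False using uv(1) xy unfolding extreme_point_of_def by blast
qed

text \<open>
  The common feature of the regular solids that makes their edges visible: the vertices lie on a
  sphere, and every pair of vertices that is not at the least distance is a diagonal crossed by
  another one. For a diagonal of a face this is the crossing of diagonals in a regular polygon.
\<close>

locale crossed_diagonals =
  fixes S :: "'a::euclidean_space set" and c :: 'a and R \<delta> :: real
  assumes finite_S: "finite S"
    and on_sphere: "S \<subseteq> sphere c R"
    and min_dist: "\<And>x y. x \<in> S \<Longrightarrow> y \<in> S \<Longrightarrow> x \<noteq> y \<Longrightarrow> \<delta> \<le> dist x y"
    and min_pos: "0 < \<delta>"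
    and crossed: "\<And>x y. x \<in> S \<Longrightarrow> y \<in> S \<Longrightarrow> x \<noteq> y \<Longrightarrow> dist x y \<noteq> \<delta> \<Longrightarrow>
      \<exists>u\<in>S. \<exists>v\<in>S. u \<notin> {x, y} \<and> open_segment x y \<inter> open_segment u v \<noteq> {}"
begin

text \<open>
  On the sphere, \<open>|w - u|\<^sup>2 + |w - v|\<^sup>2\<close> is an affine function of \<open>w\<close>, namely
  \<open>|u - v|\<^sup>2 + 2 (\<beta> - a \<bullet> w)\<close> with \<open>a = (u - c) + (v - c)\<close>. If it is least at \<open>u\<close> and \<open>v\<close> only, then
  \<open>a \<bullet> w = \<beta>\<close> is a supporting hyperplane that touches the hull exactly in \<open>[u, v]\<close>. The case
  \<open>u = v\<close> gives that every point of \<open>S\<close> is a vertex.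
\<close>

lemma face_if_minimizes_sum_of_squares:
  assumes u: "u \<in> S" and v: "v \<in> S"
    and far: "\<And>w. w \<in> S - {u, v} \<Longrightarrow> (dist u v)\<^sup>2 < (dist w u)\<^sup>2 + (dist w v)\<^sup>2"
  shows "closed_segment u v face_of convex hull S"
proof -
  define a where "a = (u - c) + (v - c)"
  define \<beta> where "\<beta> = a \<bullet> u"
  have sq: "(w - c) \<bullet> (w - c) = R\<^sup>2" if "w \<in> S" for w
    using on_sphere that by (auto simp: dist_norm norm_minus_commute dot_square_norm)
  have F: "(dist w u)\<^sup>2 + (dist w v)\<^sup>2 = (dist u v)\<^sup>2 + 2 * (\<beta> - a \<bullet> w)" if "w \<in> S" for w
  proof -
    have d: "(dist x y)\<^sup>2 = 2 * R\<^sup>2 - 2 * ((x - c) \<bullet> (y - c))" if "x \<in> S" "y \<in> S" for x y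
      using dot_norm_neg[of "x - c" "y - c"] sq[OF that(1)] sq[OF that(2)]
      by (simp add: dist_norm dot_square_norm)
    have "\<beta> - a \<bullet> w = ((u - c) + (v - c)) \<bullet> (u - c) - ((u - c) + (v - c)) \<bullet> (w - c)"
      by (simp add: a_def \<beta>_def inner_diff_right algebra_simps)
    then show ?thesis using sq[OF u] d[OF that u] d[OF that v] d[OF u v]
      by (simp add: inner_add_left inner_add_right inner_commute)
  qed
  have le: "a \<bullet> w \<le> \<beta>" and eq: "a \<bullet> w = \<beta> \<longleftrightarrow> w \<in> {u, v}" if "w \<in> S" for w
    using F[OF that] far[of w] that F[OF u] F[OF v] by (force simp: dist_commute)+
  have "convex hull S \<subseteq> {x. a \<bullet> x \<le> \<beta>}"
    by (intro hull_minimal convex_halfspace_le) (use le in auto)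
  then have face: "(convex hull S \<inter> {x. a \<bullet> x = \<beta>}) face_of convex hull S"
    by (intro face_of_Int_supporting_hyperplane_le) auto
  then obtain T where T: "T \<subseteq> S" "convex hull S \<inter> {x. a \<bullet> x = \<beta>} = convex hull T"
    using face_of_convex_hull_subset[OF finite_imp_compact[OF finite_S]] by metis
  have "T \<subseteq> convex hull T" by (rule hull_subset)
  then have "T \<subseteq> {u, v}" using T eq by blast
  moreover have "{u, v} \<subseteq> convex hull T"
    unfolding T(2)[symmetric] using u v eq hull_subset[of S convex] by auto
  ultimately have "convex hull T = convex hull {u, v}"
    by (intro antisym hull_mono hull_minimal) auto
  then show ?thesis using face T(2) by (simp add: segment_convex_hull)
qed

lemma vertices_hull: "vertices (convex hull S) = S"
proof -
  have "u extreme_point_of convex hull S" if u: "u \<in> S" for u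
  proof -
    have "closed_segment u u face_of convex hull S"
      using u by (intro face_if_minimizes_sum_of_squares) (auto simp: sum_power2_gt_zero_iff)
    then show ?thesis by (simp add: face_of_singleton)
  qed
  then show ?thesis unfolding vertices_def using extreme_point_of_convex_hull by blast
qed

lemma extreme_point_iff: "u extreme_point_of convex hull S \<longleftrightarrow> u \<in> S"
  using vertices_hull by (auto simp: vertices_def)

definition closest_pairs :: "('a \<times> 'a) set" where
  "closest_pairs = {(u, v) \<in> S \<times> S. dist u v = \<delta>}"

text \<open>
  For a closest pair \<open>u, v\<close> and any third point \<open>w\<close> one has
  \<open>|w - u|\<^sup>2 + |w - v|\<^sup>2 \<ge> 2 \<delta>\<^sup>2 > \<delta>\<^sup>2 = |u - v|\<^sup>2\<close>, so \<open>[u, v]\<close> is a face. Conversely an edge is a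
  segment between two vertices, and if these were not a closest pair, then it would be crossed.
\<close>

lemma edges_hull: "edges (convex hull S) = (\<lambda>(u, v). closed_segment u v) ` closest_pairs"
proof (intro subset_antisym subsetI)
  fix e assume "e \<in> edges (convex hull S)"
  then have face: "e face_of convex hull S" and dim: "aff_dim e = 1"
    by (auto simp: edges_def edge_of_def)
  have "compact e" "convex e"
    using face_of_imp_compact[OF _ _ face] face_of_imp_convex[OF face] finite_S
    by (simp_all add: compact_convex_hull finite_imp_compact)
  moreover have "collinear e" "e \<noteq> {}" using dim by (auto simp: collinear_aff_dim)
  ultimately obtain x y where e: "e = closed_segment x y"
    using compact_convex_collinear_segment by metis
  have "x \<noteq> y" using dim e by auto
  have xy: "x \<in> S" "y \<in> S"
    using extreme_point_of_face[OF face] extreme_point_iff unfolding e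
    by (auto simp: extreme_point_of_segment)
  have "dist x y = \<delta>"
  proof (rule ccontr)
    assume "dist x y \<noteq> \<delta>"
    then obtain u v where uv: "u \<in> S" "v \<in> S" "u \<notin> {x, y}" "open_segment x y \<inter> open_segment u v \<noteq> {}"
      using crossed[OF xy \<open>x \<noteq> y\<close>] by blast
    moreover have "v \<in> convex hull S" using uv(2) by (rule hull_inc)
    ultimately have "\<not> closed_segment x y face_of convex hull S"
      using xy by (intro crossed_segment_not_face) (auto simp: extreme_point_iff)
    then show False using face e by simp
  qed
  then show "e \<in> (\<lambda>(u, v). closed_segment u v) ` closest_pairs"
    using e xy by (auto simp: closest_pairs_def)
next
  fix e assume "e \<in> (\<lambda>(u, v). closed_segment u v) ` closest_pairs"
  then obtain u v where uv: "u \<in> S" "v \<in> S" "dist u v = \<delta>" and e: "e = closed_segment u v"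
    by (auto simp: closest_pairs_def)
  have "u \<noteq> v" using uv min_pos by auto
  have "e face_of convex hull S" unfolding e
  proof (rule face_if_minimizes_sum_of_squares)
    fix w assume w: "w \<in> S - {u, v}"
    then have "\<delta>\<^sup>2 \<le> (dist w u)\<^sup>2" "\<delta>\<^sup>2 \<le> (dist w v)\<^sup>2" "0 < \<delta>\<^sup>2"
      using min_dist[of w u] min_dist[of w v] uv min_pos by (auto intro!: power_mono)
    then show "(dist u v)\<^sup>2 < (dist w u)\<^sup>2 + (dist w v)\<^sup>2" unfolding uv(3) by linarith
  qed (use uv in auto)
  moreover have "aff_dim e = 1" 
    unfolding e segment_convex_hull aff_dim_convex_hull using \<open>u \<noteq> v\<close> by simp
  ultimately show "e \<in> edges (convex hull S)" by (simp add: edges_def edge_of_def)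
qed

lemma chords_hull:
  "chords (convex hull S) = (\<lambda>(u, v). closed_segment u v) ` {(u, v) \<in> S \<times> S. u \<noteq> v}"
  unfolding chords_def vertices_hull by auto

lemma vertices_on_segment:
  assumes "u \<in> S" "v \<in> S"
  shows "{w \<in> vertices (convex hull S). w \<in> closed_segment u v} = {u, v}"
proof -
  have "w \<in> {u, v}" if "w \<in> S" "w \<in> closed_segment u v" for w
  proof (rule ccontr)
    assume "w \<notin> {u, v}"
    then have "w \<in> open_segment u v" using that by (auto simp: open_segment_def)
    moreover have "u \<in> convex hull S" "v \<in> convex hull S" using assms by (auto intro: hull_inc)
    moreover have "w extreme_point_of convex hull S" using that extreme_point_iff by simp
    ultimately show False by (auto simp: extreme_point_of_def)
  qed
  then show ?thesis using assms by (auto simp: vertices_hull)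
qed

lemma card_vertices_of_edge:
  assumes "e \<in> edges (convex hull S)"
  shows "card {w \<in> vertices (convex hull S). w \<in> e} = 2"
proof -
  obtain u v where "u \<in> S" "v \<in> S" "dist u v = \<delta>" "e = closed_segment u v"
    using assms by (auto simp: edges_hull closest_pairs_def)
  then show ?thesis using vertices_on_segment[of u v] min_pos by (auto simp: card_insert_if)
qed

lemma card_edges_at_vertex:
  assumes "u \<in> S"
  shows "card {e \<in> edges (convex hull S). u \<in> e} = card {v \<in> S. dist u v = \<delta>}"
proof -
  have "{e \<in> edges (convex hull S). u \<in> e} = closed_segment u ` {v \<in> S. dist u v = \<delta>}"
  proof (intro subset_antisym subsetI)
    fix e assume "e \<in> {e \<in> edges (convex hull S). u \<in> e}"
    then obtain x y where xy: "x \<in> S" "y \<in> S" "dist x y = \<delta>" "e = closed_segment x y"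
      and "u \<in> closed_segment x y"
      by (auto simp: edges_hull closest_pairs_def)
    then have "u \<in> {x, y}" using vertices_on_segment[of x y] assms by (auto simp: vertices_hull)
    then show "e \<in> closed_segment u ` {v \<in> S. dist u v = \<delta>}"
      using xy by (auto simp: dist_commute closed_segment_commute)
  qed (use assms in \<open>auto simp: edges_hull closest_pairs_def\<close>)
  moreover have "inj_on (closed_segment u) {v \<in> S. dist u v = \<delta>}"
    by (auto simp: inj_on_def doubleton_eq_iff)
  ultimately show ?thesis by (simp add: card_image)
qed

text \<open>
  Every edge is counted at its two ends; the count is obtained from the doubling lemma for
  products by multiplying a factor 2 for every edge.
\<close>

lemma handshake:
  assumes deg: "\<And>u. u \<in> S \<Longrightarrow> card {v \<in> S. dist u v = \<delta>} = k"
  shows "2 * card (edges (convex hull S)) = k * card S"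
proof -
  have fin: "finite closest_pairs"
    unfolding closest_pairs_def by (rule finite_subset[of _ "S \<times> S"]) (use finite_S in auto)
  have "(\<Prod>(u, v)\<in>closest_pairs. 2) = (\<Prod>e\<in>edges (convex hull S). 2::nat) ^ 2"
    unfolding edges_hull using min_pos fin
    by (intro prod_segments_squared) (auto simp: closest_pairs_def dist_commute)
  then have "(2::nat) ^ card closest_pairs = 2 ^ (2 * card (edges (convex hull S)))"
    by (simp add: case_prod_unfold power_mult[symmetric] mult.commute)
  moreover have "closest_pairs = (SIGMA u:S. {v \<in> S. dist u v = \<delta>})"
    by (auto simp: closest_pairs_def)
  ultimately show ?thesis using deg finite_S by (simp add: card_SigmaI mult.commute)
qed

lemma chord_product_squared:
  assumes K: "\<And>u. u \<in> S \<Longrightarrow> (\<Prod>v\<in>S - {u}. (dist u v)\<^sup>2) = K"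
  shows "(\<Prod>s\<in>chords (convex hull S). (diameter s)\<^sup>2)\<^sup>2 = K ^ card S"
proof -
  let ?A = "{(u, v) \<in> S \<times> S. u \<noteq> v}"
  have A: "?A = (SIGMA u:S. S - {u})" by auto
  have "(\<Prod>s\<in>chords (convex hull S). (diameter s)\<^sup>2)\<^sup>2
      = (\<Prod>(u, v)\<in>?A. (diameter (closed_segment u v))\<^sup>2)"
    unfolding chords_hull using finite_S
    by (intro prod_segments_squared[symmetric] finite_subset[of ?A "S \<times> S"]) auto
  also have "\<dots> = (\<Prod>u\<in>S. \<Prod>v\<in>S - {u}. (dist u v)\<^sup>2)"
    unfolding A using finite_S by (simp add: diameter_closed_segment_eq_dist prod.Sigma)
  finally show ?thesis using K by simp
qed

lemma chord_lengths_hull: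
  "chord_lengths (convex hull S) = {dist u v | u v. u \<in> S \<and> v \<in> S \<and> u \<noteq> v}"
  unfolding chord_lengths_def chords_def vertices_hull
  by (force simp: diameter_closed_segment_eq_dist)

text \<open>
  Seen from \<open>c\<close>, two spheres through \<open>S\<close> centred at \<open>c\<close> and \<open>z\<close> force \<open>(x - c) \<bullet> (c - z)\<close> to be the same
  number for all \<open>x\<close> in \<open>S\<close>. As the vectors \<open>x - c\<close> add up to zero, this number is zero, and as they
  span the space, \<open>c = z\<close>.
\<close>

lemma circumradius_unique:
  assumes S: "S \<noteq> {}" "S \<subseteq> sphere z \<rho>"
    and centred: "(\<Sum>x\<in>S. x - c) = 0"
    and spanning: "\<And>y. (\<And>x. x \<in> S \<Longrightarrow> (x - c) \<bullet> y = 0) \<Longrightarrow> y = 0"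
  shows "\<rho> = R"
proof -
  define \<kappa> where "\<kappa> = (\<rho>\<^sup>2 - R\<^sup>2 - (c - z) \<bullet> (c - z)) / 2"
  have \<kappa>: "(x - c) \<bullet> (c - z) = \<kappa>" if "x \<in> S" for x
  proof -
    have "norm (x - z) = \<rho>" "norm (x - c) = R"
      using that S(2) on_sphere by (auto simp: dist_norm norm_minus_commute)
    then show ?thesis
      using dot_norm[of "x - c" "c - z"] by (simp add: \<kappa>_def dot_square_norm)
  qed
  have "of_nat (card S) * \<kappa> = (\<Sum>x\<in>S. x - c) \<bullet> (c - z)"
    by (simp add: inner_sum_left \<kappa>)
  then have "\<kappa> = 0" using centred S finite_S by simp
  then have "c - z = 0" using spanning[of "c - z"] \<kappa> by simp
  moreover obtain x where "x \<in> S" using S(1) by auto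
  ultimately show ?thesis using S(2) on_sphere by (auto simp: subset_iff)
qed

end

section \<open>Coordinates in the ring of golden integers\<close>

text \<open>
  \<open>Golden a b\<close> stands for \<open>a + b \<phi>\<close>, where \<open>\<phi>\<close> is the golden ratio. With suitable scaling all
  coordinates of the five solids lie in this ring, where equality is decided by comparing
  integers; multiplication uses \<open>\<phi>\<^sup>2 = \<phi> + 1\<close>.
\<close>

datatype golden_int = Golden int int

instantiation golden_int :: comm_ring_1
begin

definition "0 = Golden 0 0"
definition "1 = Golden 1 0"

fun plus_golden_int where "Golden a b + Golden c d = Golden (a + c) (b + d)"
fun uminus_golden_int where "- Golden a b = Golden (- a) (- b)"
fun minus_golden_int where "Golden a b - Golden c d = Golden (a - c) (b - d)"
fun times_golden_int where
  "Golden a b * Golden c d = Golden (a * c + b * d) (a * d + b * c + b * d)"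

instance
proof
  fix x y z :: golden_int
  show "x * y * z = x * (y * z)" by (cases x; cases y; cases z) (simp add: algebra_simps)
  show "x * y = y * x" by (cases x; cases y) (simp add: algebra_simps)
  show "1 * x = x" by (cases x) (simp add: one_golden_int_def)
  show "(x + y) * z = x * z + y * z" by (cases x; cases y; cases z) (simp add: algebra_simps)
  show "x + y + z = x + (y + z)" by (cases x; cases y; cases z) simp
  show "x + y = y + x" by (cases x; cases y) simp
  show "0 + x = x" by (cases x) (simp add: zero_golden_int_def)
  show "- x + x = 0" by (cases x) (simp add: zero_golden_int_def)
  show "x - y = x + - y" by (cases x; cases y) simp
  show "(0::golden_int) \<noteq> 1" by (simp add: zero_golden_int_def one_golden_int_def)
qed

end

fun golden_real :: "golden_int \<Rightarrow> real" where
  "golden_real (Golden a b) = of_int a + of_int b * golden_ratio"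

lemma golden_ratio_squared: "golden_ratio * golden_ratio = golden_ratio + 1"
  by (simp add: golden_ratio_def field_simps)

lemma golden_ratio_pos: "0 < golden_ratio"
  by (simp add: golden_ratio_def add_pos_nonneg)

lemma golden_real_add [simp]: "golden_real (x + y) = golden_real x + golden_real y"
  by (cases x; cases y) (simp add: algebra_simps)

lemma golden_real_minus [simp]: "golden_real (x - y) = golden_real x - golden_real y"
  by (cases x; cases y) (simp add: algebra_simps)

lemma golden_real_uminus [simp]: "golden_real (- x) = - golden_real x"
  by (cases x) simp

lemma golden_real_0 [simp]: "golden_real 0 = 0"
  by (simp add: zero_golden_int_def)

lemma golden_real_1 [simp]: "golden_real 1 = 1"
  by (simp add: one_golden_int_def)

lemma golden_real_mult [simp]: "golden_real (x * y) = golden_real x * golden_real y"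
proof (cases x; cases y)
  fix a b c d assume "x = Golden a b" "y = Golden c d"
  moreover have "(of_int b * golden_ratio) * (of_int d * golden_ratio)
      = of_int b * of_int d * (golden_ratio + 1)"
    unfolding golden_ratio_squared[symmetric] by simp
  ultimately show ?thesis by (simp add: algebra_simps)
qed

lemma golden_real_power [simp]: "golden_real (x ^ n) = golden_real x ^ n"
  by (induction n) auto

lemma golden_real_numeral [simp]: "golden_real (numeral n) = numeral n"
  by (induction n) (simp_all only: numeral.simps golden_real_add golden_real_1)

lemma golden_real_prod_list: "golden_real (prod_list xs) = prod_list (map golden_real xs)"
  by (induction xs) auto

text \<open>
  The prime 5 occurs to an even power on the left and, unless \<open>y = 0\<close>, to an odd power on the right.
\<close>

lemma five_times_square_not_square:
  fixes x y :: int
  assumes "x\<^sup>2 = 5 * y\<^sup>2"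
  shows "y = 0"
proof (rule ccontr)
  assume "y \<noteq> 0"
  then have "x \<noteq> 0" using assms by auto
  have p: "prime_elem (5::int)" by simp
  have "2 * multiplicity 5 x = multiplicity 5 (5 * y\<^sup>2)"
    using prime_elem_multiplicity_power_distrib[OF p \<open>x \<noteq> 0\<close>, of 2] assms by simp
  also have "\<dots> = 1 + 2 * multiplicity 5 y"
    using p \<open>y \<noteq> 0\<close>
    by (simp add: prime_elem_multiplicity_mult_distrib prime_elem_multiplicity_power_distrib)
  finally show False by presburger
qed

text \<open>
  The irrationality of \<open>\<surd>5\<close>: it makes the embedding into the reals injective, so that
  computed (in)equalities of coordinates and squared distances transfer to the actual solids.
\<close>

lemma golden_real_eq_0_iff: "golden_real x = 0 \<longleftrightarrow> x = 0"
proof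
  assume x: "golden_real x = 0"
  obtain a b where ab: "x = Golden a b" by (cases x)
  have "of_int (2 * a + b) = - (of_int b * sqrt 5)"
    using x by (simp add: ab golden_ratio_def field_simps)
  then have "(of_int (2 * a + b))\<^sup>2 = 5 * (of_int b :: real)\<^sup>2"
    by (simp add: power_mult_distrib)
  then have "(of_int ((2 * a + b)\<^sup>2) :: real) = of_int (5 * b\<^sup>2)"
    by (simp only: of_int_power of_int_mult of_int_numeral)
  then have "(2 * a + b)\<^sup>2 = 5 * b\<^sup>2" by (simp only: of_int_eq_iff)
  then have "b = 0" by (rule five_times_square_not_square)
  then show "x = 0" using x by (simp add: ab zero_golden_int_def)
qed auto

lemma golden_real_eq_iff [simp]: "golden_real x = golden_real y \<longleftrightarrow> x = y"
  using golden_real_eq_0_iff[of "x - y"] by simp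

type_synonym golden_point = "golden_int \<times> golden_int \<times> golden_int"

fun point :: "golden_point \<Rightarrow> real ^ 3" where
  "point (x, y, z) = vector [golden_real x, golden_real y, golden_real z]"

fun scale :: "golden_int \<Rightarrow> golden_point \<Rightarrow> golden_point" where
  "scale l (x, y, z) = (l * x, l * y, l * z)"

fun sqnorm :: "golden_point \<Rightarrow> golden_int" where
  "sqnorm (x, y, z) = x * x + y * y + z * z"

lemma point_0 [simp]: "point 0 = 0"
  by (simp add: zero_prod_def vec_eq_iff forall_3 vector_3)

lemma point_add [simp]: "point (p + q) = point p + point q"
  by (cases p; cases q) (simp add: vec_eq_iff forall_3 vector_3)

lemma point_diff [simp]: "point (p - q) = point p - point q"
  by (cases p; cases q) (simp add: vec_eq_iff forall_3 vector_3)

lemma point_scale [simp]: "point (scale l p) = golden_real l *\<^sub>R point p"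
  by (cases p) (simp add: vec_eq_iff forall_3 vector_3)

lemma point_sum_list: "point (sum_list ps) = sum_list (map point ps)"
  by (induction ps) auto

lemma inner_point: "point (x, y, z) \<bullet> v = golden_real x * v $ 1 + golden_real y * v $ 2 + golden_real z * v $ 3"
  by (simp add: inner_vec_def sum_3 vector_3)

lemma golden_real_sqnorm: "golden_real (sqnorm p) = (norm (point p))\<^sup>2"
  by (cases p) (simp add: power2_norm_eq_inner inner_vec_def sum_3 vector_3)

section \<open>Solids given by lists of vertices\<close>

text \<open>
  The point \<open>(p + l q) / (1 + l)\<close> of \<open>[p, q]\<close> lies on \<open>[v, w]\<close> at the same ratio exactly when
  \<open>v = p + l (q - w)\<close>. The case \<open>l = 1\<close> is that of the two diagonals of a parallelogram, and
  \<open>l = \<phi>\<close> that of two diagonals of a regular pentagon, which cut each other in the golden ratio.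
\<close>

definition crosses :: "golden_point list \<Rightarrow> golden_point \<Rightarrow> golden_point \<Rightarrow> golden_int \<Rightarrow> golden_point \<Rightarrow> bool" where
  "crosses L p q l w \<longleftrightarrow>
     (let v = p + scale l (q - w) in v \<noteq> p \<and> v \<noteq> q \<and> v \<noteq> w \<and> v \<in> set L)"

text \<open>
  An executable description of a solid by the list \<open>L\<close> of its vertices: \<open>R\<close> is the squared
  circumradius about the origin, \<open>D\<close> lists the squared distances between distinct vertices with
  the squared edge length first, \<open>k\<close> is the number of neighbours of each vertex, and \<open>K\<close> the product of the
  squared distances from a vertex to all others. For the last condition, every diagonal of a
  regular solid is a diagonal of a parallelogram or of a regular pentagon formed by vertices;
  besides the faces, such pentagons are the vertex figures of the icosahedron and the sections of
  the dodecahedron through the outer ends of the five edges leaving a face.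
\<close>

definition golden_solid ::
  "golden_point list \<Rightarrow> golden_int \<Rightarrow> golden_int list \<Rightarrow> nat \<Rightarrow> golden_int \<Rightarrow> bool" where
  "golden_solid L R D k K \<longleftrightarrow>
     distinct L \<and> distinct D \<and> L \<noteq> [] \<and> sum_list L = 0 \<and>
     (\<forall>p\<in>set L. sqnorm p = R) \<and>
     (\<forall>p\<in>set L. \<forall>q\<in>set L. p \<noteq> q \<longrightarrow> sqnorm (p - q) \<in> set D) \<and>
     (\<forall>e\<in>set D. \<exists>q\<in>set L. hd L \<noteq> q \<and> sqnorm (hd L - q) = e) \<and>
     (\<forall>p\<in>set L. length (filter (\<lambda>q. sqnorm (p - q) = hd D) L) = k) \<and>
     (\<forall>p\<in>set L. prod_list (map (\<lambda>q. sqnorm (p - q)) (filter (\<lambda>q. q \<noteq> p) L)) = K) \<and>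
     (\<forall>p\<in>set L. \<forall>q\<in>set L. p \<noteq> q \<longrightarrow> sqnorm (p - q) \<noteq> hd D \<longrightarrow>
        (\<exists>w\<in>set L. crosses L p q 1 w \<or> crosses L p q (Golden 0 1) w))"

lemma open_segments_meet:
  fixes x y u v :: "'a::real_vector"
  assumes "0 < l" "x \<noteq> y" "u \<noteq> v" and eq: "x + l *\<^sub>R y = u + l *\<^sub>R v"
  shows "open_segment x y \<inter> open_segment u v \<noteq> {}"
proof -
  define s where "s = l / (1 + l)"
  have s: "0 < s" "s < 1" "1 - s = 1 / (1 + l)" using assms(1) by (auto simp: s_def field_simps)
  have "(1 - s) *\<^sub>R a + s *\<^sub>R b = (1 / (1 + l)) *\<^sub>R (a + l *\<^sub>R b)" for a b :: 'a
    unfolding s(3) by (simp add: s_def scaleR_add_right)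
  then have "(1 - s) *\<^sub>R x + s *\<^sub>R y = (1 - s) *\<^sub>R u + s *\<^sub>R v" using eq by simp
  then have "(1 - s) *\<^sub>R x + s *\<^sub>R y \<in> open_segment x y \<inter> open_segment u v"
    using s assms by (auto simp: in_segment)
  then show ?thesis by blast
qed

text \<open>
  \<open>Q\<close> multiplies the squared lengths of all chords, \<open>q\<close> only those of the distinct lengths.
\<close>

definition metric_data :: "'a::euclidean_space set \<Rightarrow> nat \<Rightarrow> nat \<Rightarrow> nat \<Rightarrow> real \<Rightarrow> real \<Rightarrow> bool" where
  "metric_data P V E k Q q \<longleftrightarrow>
     card (vertices P) = V \<and> card (edges P) = E \<and>
     (\<forall>e\<in>edges P. card {v \<in> vertices P. v \<in> e} = 2) \<and>
     (\<forall>v\<in>vertices P. card {e \<in> edges P. v \<in> e} = k) \<and>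
     (\<Prod>s\<in>chords P. (diameter s)\<^sup>2) = Q \<and> (\<Prod>l\<in>chord_lengths P. l\<^sup>2) = q"

text \<open>
  A similarity with factor \<open>r\<close> multiplies squared distances by \<open>r\<^sup>2\<close> and preserves crossings, so every
  similar copy of the solid has crossed diagonals. Being inscribed in a unit sphere forces
  \<open>r\<^sup>2 R = 1\<close>, so squared chord lengths are the entries of \<open>D\<close> divided by \<open>R\<close>. The chord product is
  recovered from its square, in which each of the \<open>n\<close> vertices contributes \<open>\<kappa> = K / R^(n - 1)\<close>.
\<close>

lemma golden_solid_metric_data:
  fixes P :: "(real ^ 3) set"
  assumes solid: "golden_solid L R (d # D) k K"
    and spanning: "\<And>y. (\<And>p. p \<in> set L \<Longrightarrow> point p \<bullet> y = 0) \<Longrightarrow> y = 0"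
    and least: "0 < golden_real d" "\<And>e. e \<in> set D \<Longrightarrow> golden_real d \<le> golden_real e"
    and P: "similar_to P (convex hull (point ` set L))"
    and inscribed: "inscribed_in_sphere P 1"
    and n: "length L = n" and E: "2 * E = k * n"
    and K: "golden_real K / golden_real R ^ (n - 1) = \<kappa>"
    and Q: "0 \<le> Q" "\<kappa> ^ n = Q\<^sup>2"
    and q: "q = (\<Prod>e\<leftarrow>d # D. golden_real e / golden_real R)"
  shows "metric_data P n E k Q q"
proof -
  obtain r f t where r: "0 < r" and f: "orthogonal_transformation f"
    and P_eq: "P = (\<lambda>x. t + r *\<^sub>R f x) ` (convex hull (point ` set L))"
    using P by (auto simp: similar_to_def)
  have lin: "linear f" using f by (rule orthogonal_transformation_linear)
  define G where "G p = t + r *\<^sub>R f (point p)" for p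
  define S where "S = G ` set L"
  let ?sq = "\<lambda>p q. sqnorm (p - q)"
  have hull: "P = convex hull S"
  proof -
    have "linear (\<lambda>x. r *\<^sub>R f x)" using lin by (rule linear_compose_scale_right)
    then have "convex hull ((\<lambda>x. r *\<^sub>R f x) ` point ` set L)
        = (\<lambda>x. r *\<^sub>R f x) ` (convex hull (point ` set L))"
      by (rule convex_hull_linear_image[symmetric])
    moreover have "S = (\<lambda>x. t + x) ` (\<lambda>x. r *\<^sub>R f x) ` point ` set L"
      by (auto simp: S_def G_def image_image)
    ultimately have "convex hull S = (\<lambda>x. t + x) ` (\<lambda>x. r *\<^sub>R f x) ` (convex hull (point ` set L))"
      by (simp only: convex_hull_translation)
    then show ?thesis by (simp only: P_eq image_image)
  qed
  have solidD: "distinct L" "distinct (d # D)" "L \<noteq> []" "sum_list L = 0"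
    "\<And>p. p \<in> set L \<Longrightarrow> sqnorm p = R"
    "\<And>p q. p \<in> set L \<Longrightarrow> q \<in> set L \<Longrightarrow> p \<noteq> q \<Longrightarrow> ?sq p q \<in> set (d # D)"
    "\<And>e. e \<in> set (d # D) \<Longrightarrow> \<exists>q\<in>set L. hd L \<noteq> q \<and> ?sq (hd L) q = e"
    "\<And>p. p \<in> set L \<Longrightarrow> length (filter (\<lambda>q. ?sq p q = d) L) = k"
    "\<And>p. p \<in> set L \<Longrightarrow> prod_list (map (\<lambda>q. ?sq p q) (filter (\<lambda>q. q \<noteq> p) L)) = K"
    "\<And>p q. p \<in> set L \<Longrightarrow> q \<in> set L \<Longrightarrow> p \<noteq> q \<Longrightarrow> ?sq p q \<noteq> d \<Longrightarrow>
       (\<exists>w\<in>set L. crosses L p q 1 w \<or> crosses L p q (Golden 0 1) w)"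
    using solid unfolding golden_solid_def list.sel by (elim conjE; assumption | (erule bspec; assumption) | meson)+
  have dist_G: "dist (G p) (G q) = r * sqrt (golden_real (?sq p q))" for p q
  proof -
    have "G p - G q = r *\<^sub>R f (point (p - q))"
      by (simp add: G_def linear_diff[OF lin] scaleR_diff_right)
    then show ?thesis using r
      by (simp only: dist_norm norm_scaleR orthogonal_transformation_norm[OF f] golden_real_sqnorm
          real_sqrt_abs abs_norm_cancel abs_of_pos)
  qed
  have dist_centre: "dist t (G p) = r * sqrt (golden_real R)" if "p \<in> set L" for p
    using r by (simp add: dist_norm G_def solidD(5)[OF that, symmetric] golden_real_sqnorm
        orthogonal_transformation_norm[OF f])
  have pos: "0 < golden_real e" if "e \<in> set (d # D)" for e
    using that least by force
  have G_eq: "G p = G q \<longleftrightarrow> p = q" if "p \<in> set L" "q \<in> set L" for p q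
    using dist_G[of p q] pos[OF solidD(6)[OF that]] r by (cases "p = q") auto
  have inj: "inj_on G (set L)" by (auto simp: inj_on_def G_eq)
  have crossing: "open_segment (G p) (G q) \<inter> open_segment (G v) (G w) \<noteq> {}"
    if pq: "p \<in> set L" "q \<in> set L" "p \<noteq> q" and w: "w \<in> set L" and v: "v \<in> set L" "v \<noteq> w"
      "v = p + scale l (q - w)" and l: "0 < golden_real l" for p q v w l
  proof (rule open_segments_meet[OF l])
    have "point p + golden_real l *\<^sub>R point q = point v + golden_real l *\<^sub>R point w"
      by (simp add: v(3) scaleR_diff_right)
    then have "f (point p) + golden_real l *\<^sub>R f (point q) = f (point v) + golden_real l *\<^sub>R f (point w)"
      by (simp only: linear_add[OF lin, symmetric] linear_scale[OF lin, symmetric])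
    then have "r *\<^sub>R (f (point p) + golden_real l *\<^sub>R f (point q))
      = r *\<^sub>R (f (point v) + golden_real l *\<^sub>R f (point w))" by simp
    then show "G p + golden_real l *\<^sub>R G q = G v + golden_real l *\<^sub>R G w"
      by (simp add: G_def scaleR_add_right mult.commute)
  qed (use G_eq pq w v in auto)
  interpret crossed_diagonals S t "r * sqrt (golden_real R)" "r * sqrt (golden_real d)"
  proof
    show "finite S" by (simp add: S_def)
    show "S \<subseteq> sphere t (r * sqrt (golden_real R))" by (auto simp: S_def dist_centre)
    show "0 < r * sqrt (golden_real d)" using r least by simp
  next
    fix x y assume "x \<in> S" "y \<in> S" "x \<noteq> y"
    then obtain p q where pq: "p \<in> set L" "q \<in> set L" "p \<noteq> q" "x = G p" "y = G q"
      unfolding S_def by blast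
    then have "golden_real d \<le> golden_real (?sq p q)"
      using solidD(6)[OF pq(1-3)] least(2) by auto
    then show "r * sqrt (golden_real d) \<le> dist x y" using r pq by (simp add: dist_G)
    assume "dist x y \<noteq> r * sqrt (golden_real d)"
    then have "?sq p q \<noteq> d" using pq by (auto simp: dist_G)
    then obtain w l where w: "w \<in> set L" "crosses L p q l w" and l: "0 < golden_real l"
      using solidD(10)[OF pq(1-3)] golden_ratio_pos by force
    define v where "v = p + scale l (q - w)"
    have v: "v \<in> set L" "v \<noteq> p" "v \<noteq> q" "v \<noteq> w"
      using w(2) by (auto simp only: crosses_def Let_def v_def)
    then have "G v \<notin> {x, y}" "open_segment x y \<inter> open_segment (G v) (G w) \<noteq> {}"
      using pq G_eq[OF v(1)] crossing[OF pq(1-3) w(1) v(1,4) v_def l] by auto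
    then show "\<exists>u\<in>S. \<exists>v\<in>S. u \<notin> {x, y} \<and> open_segment x y \<inter> open_segment u v \<noteq> {}"
      using v(1) w(1) unfolding S_def by blast
  qed
  have R: "r\<^sup>2 * golden_real R = 1"
  proof -
    obtain z where "S \<subseteq> sphere z 1"
      using inscribed by (auto simp: inscribed_in_sphere_def hull vertices_hull)
    moreover have "(\<Sum>x\<in>S. x - t) = 0"
    proof -
      have "(\<Sum>x\<in>S. x - t) = (\<Sum>p\<in>set L. r *\<^sub>R f (point p))"
        unfolding S_def sum.reindex[OF inj] by (simp add: G_def)
      also have "\<dots> = r *\<^sub>R f (\<Sum>p\<in>set L. point p)"
        by (simp add: linear_sum[OF lin] scaleR_sum_right)
      also have "(\<Sum>p\<in>set L. point p) = point (sum_list L)"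
        by (simp add: point_sum_list sum.distinct_set_conv_list solidD(1))
      finally show ?thesis by (simp add: solidD(4) linear_0[OF lin])
    qed
    moreover have "y = 0" if y: "\<And>x. x \<in> S \<Longrightarrow> (x - t) \<bullet> y = 0" for y
    proof -
      obtain y' where y': "y = f y'" using orthogonal_transformation_surj[OF f] by (metis surjD)
      have "point p \<bullet> y' = 0" if "p \<in> set L" for p
        using y[of "G p"] that r f by (simp add: S_def G_def y' orthogonal_transformation_def)
      then show ?thesis using spanning[of y'] by (simp add: y' linear_0[OF lin])
    qed
    moreover have "S \<noteq> {}" using solidD(3) by (simp add: S_def)
    ultimately have "1 = r * sqrt (golden_real R)" by (metis circumradius_unique)
    then have "1 = (r * sqrt (golden_real R))\<^sup>2" by simp
    also have "\<dots> = r\<^sup>2 * golden_real R"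
      using golden_real_sqnorm[of "hd L"] solidD(5)[of "hd L"] solidD(3)
      by (simp add: power_mult_distrib)
    finally show ?thesis by simp
  qed
  have sq: "(r * sqrt (golden_real e))\<^sup>2 = golden_real e / golden_real R" if "e \<in> set (d # D)" for e
  proof -
    have "golden_real R \<noteq> 0" using R by auto
    then have "r\<^sup>2 = 1 / golden_real R" using R by (simp add: field_simps)
    then show ?thesis using pos[OF that] by (simp add: power_mult_distrib)
  qed
  have card_S: "card S = n"
    by (simp add: S_def card_image[OF inj] distinct_card solidD(1) n)
  have deg: "card {v \<in> S. dist u v = r * sqrt (golden_real d)} = k" if "u \<in> S" for u
  proof -
    obtain p where p: "p \<in> set L" "u = G p" using \<open>u \<in> S\<close> unfolding S_def by blast
    have "{v \<in> S. dist u v = r * sqrt (golden_real d)} = G ` set (filter (\<lambda>q. ?sq p q = d) L)"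
      using r by (auto simp: S_def p dist_G)
    also have "card \<dots> = card (set (filter (\<lambda>q. ?sq p q = d) L))"
      by (rule card_image) (rule inj_on_subset[OF inj], auto)
    finally show ?thesis using solidD(1) solidD(8)[OF p(1)] by (simp only: distinct_card distinct_filter)
  qed
  have prod_at: "(\<Prod>v\<in>S - {u}. (dist u v)\<^sup>2) = \<kappa>"
    if "u \<in> S" for u
  proof -
    obtain p where p: "p \<in> set L" "u = G p" using \<open>u \<in> S\<close> unfolding S_def by blast
    let ?L = "filter (\<lambda>q. q \<noteq> p) L"
    have "S - {u} = G ` set ?L" using p by (auto simp: S_def G_eq)
    then have "(\<Prod>v\<in>S - {u}. (dist u v)\<^sup>2) = (\<Prod>q\<in>set ?L. (dist (G p) (G q))\<^sup>2)"
      by (simp only: p(2)) (rule prod.reindex_cong[OF inj_on_subset[OF inj]], auto)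
    also have "\<dots> = (\<Prod>q\<in>set ?L. golden_real (?sq p q) / golden_real R)"
    proof (rule prod.cong[OF refl])
      fix q assume "q \<in> set ?L"
      then have "?sq p q \<in> set (d # D)" by (intro solidD(6) p(1)) auto
      then show "(dist (G p) (G q))\<^sup>2 = golden_real (?sq p q) / golden_real R"
        unfolding dist_G by (rule sq)
    qed
    also have "\<dots> = (\<Prod>q\<in>set ?L. golden_real (?sq p q)) / golden_real R ^ card (set ?L)"
      by (simp add: prod_dividef)
    also have "set ?L = set L - {p}" by auto
    also have "card (set L - {p}) = n - 1"
      using p(1) solidD(1) by (simp add: distinct_card n)
    also have "(\<Prod>q\<in>set L - {p}. golden_real (?sq p q)) = (\<Prod>q\<in>set ?L. golden_real (?sq p q))"
      by (rule prod.cong) auto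
    also have "\<dots> = golden_real K"
      unfolding solidD(9)[OF p(1), symmetric] golden_real_prod_list
      by (subst prod.distinct_set_conv_list) (simp_all add: solidD(1) comp_def del: golden_real_minus)
    finally show ?thesis using K by simp
  qed
  have "(\<Prod>s\<in>chords P. (diameter s)\<^sup>2)\<^sup>2 = \<kappa> ^ card S"
    unfolding hull by (rule chord_product_squared) (rule prod_at)
  then have "(\<Prod>s\<in>chords P. (diameter s)\<^sup>2)\<^sup>2 = Q\<^sup>2"
    by (simp only: card_S Q(2))
  then have "(\<Prod>s\<in>chords P. (diameter s)\<^sup>2) = Q"
    using Q(1) by (simp add: power2_eq_iff_nonneg prod_nonneg)
  moreover have "(\<Prod>l\<in>chord_lengths P. l\<^sup>2) = q"
  proof -
    have "chord_lengths P = (\<lambda>e. r * sqrt (golden_real e)) ` set (d # D)"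
    proof (intro subset_antisym subsetI)
      fix l assume "l \<in> chord_lengths P"
      then obtain x y where "x \<in> S" "y \<in> S" "x \<noteq> y" "l = dist x y"
        unfolding hull chord_lengths_hull by blast
      then obtain p q where "p \<in> set L" "q \<in> set L" "p \<noteq> q" "l = dist (G p) (G q)"
        unfolding S_def by blast
      then show "l \<in> (\<lambda>e. r * sqrt (golden_real e)) ` set (d # D)"
        using solidD(6)[of p q] by (auto simp only: dist_G)
    next
      fix l assume "l \<in> (\<lambda>e. r * sqrt (golden_real e)) ` set (d # D)"
      then obtain e where e: "e \<in> set (d # D)" "l = r * sqrt (golden_real e)" by blast
      then obtain q where "q \<in> set L" "hd L \<noteq> q" "?sq (hd L) q = e" using solidD(7) by blast
      then have "l = dist (G (hd L)) (G q)" "G (hd L) \<in> S" "G q \<in> S" "G (hd L) \<noteq> G q"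
        using e solidD(3) by (auto simp: dist_G S_def G_eq)
      then show "l \<in> chord_lengths P" unfolding hull chord_lengths_hull by blast
    qed
    then have "(\<Prod>l\<in>chord_lengths P. l\<^sup>2) = (\<Prod>e\<in>set (d # D). (r * sqrt (golden_real e))\<^sup>2)"
      using r by (simp only:) (rule prod.reindex_cong[OF _ refl refl], auto simp: inj_on_def)
    also have "\<dots> = (\<Prod>e\<in>set (d # D). golden_real e / golden_real R)"
      by (rule prod.cong[OF refl sq])
    also have "\<dots> = q"
      unfolding q by (rule prod.distinct_set_conv_list[OF solidD(2)])
    finally show ?thesis .
  qed
  moreover have "card (edges P) = E"
  proof -
    have "2 * card (edges P) = k * card S" unfolding hull by (rule handshake) (rule deg)
    then show ?thesis using E by (simp add: card_S)
  qed
  ultimately show ?thesis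
    using card_vertices_of_edge card_edges_at_vertex deg
    unfolding metric_data_def hull by (simp add: vertices_hull card_S)
qed

section \<open>The five regular solids\<close>

abbreviation signs :: "golden_int list" where "signs \<equiv> [-1, 1]"
abbreviation phi :: golden_int where "phi \<equiv> Golden 0 1"
abbreviation inv_phi :: golden_int where "inv_phi \<equiv> Golden (-1) 1"

definition tetrahedron_points :: "golden_point list" where
  "tetrahedron_points = [(1, 1, 1), (1, -1, -1), (-1, 1, -1), (-1, -1, 1)]"

definition octahedron_points :: "golden_point list" where
  "octahedron_points = [(1, 0, 0), (-1, 0, 0), (0, 1, 0), (0, -1, 0), (0, 0, 1), (0, 0, -1)]"

definition cube_points :: "golden_point list" where
  "cube_points = [(x, y, z). x \<leftarrow> signs, y \<leftarrow> signs, z \<leftarrow> signs]"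

definition icosahedron_points :: "golden_point list" where
  "icosahedron_points =
     [(0, s, t * phi). s \<leftarrow> signs, t \<leftarrow> signs] @
     [(t * phi, 0, s). s \<leftarrow> signs, t \<leftarrow> signs] @
     [(s, t * phi, 0). s \<leftarrow> signs, t \<leftarrow> signs]"

definition dodecahedron_points :: "golden_point list" where
  "dodecahedron_points =
     cube_points @
     [(0, s * inv_phi, t * phi). s \<leftarrow> signs, t \<leftarrow> signs] @
     [(t * phi, 0, s * inv_phi). s \<leftarrow> signs, t \<leftarrow> signs] @
     [(s * inv_phi, t * phi, 0). s \<leftarrow> signs, t \<leftarrow> signs]"

text \<open>
  The values of \<open>K\<close> are written in the form in which they are divided by \<open>R^(n - 1)\<close> later on. For
  the icosahedron \<open>K\<close> is irrational, as is \<open>R = 2 + \<phi>\<close>, but the quotient is rational.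
\<close>

lemma golden_solid_tetrahedron: "golden_solid tetrahedron_points 3 [8] 3 (8 ^ 3)"
  by code_simp

lemma golden_solid_octahedron: "golden_solid octahedron_points 1 [2, 4] 4 (2 ^ 6)"
  by code_simp

lemma golden_solid_cube: "golden_solid cube_points 3 [4, 8, 12] 3 (2 ^ 17 * 3)"
  by code_simp

lemma golden_solid_icosahedron:
  "golden_solid icosahedron_points (2 + phi) [4, 4 * (1 + phi), 4 * (2 + phi)] 5
     (2 ^ 22 * phi ^ 10 * (2 + phi))"
  by code_simp

lemma golden_solid_dodecahedron:
  "golden_solid dodecahedron_points 3 [8 - 4 * phi, 4, 8, 4 + 4 * phi, 12] 3 (2 ^ 44 * 3)"
  by code_simp

lemma divide_golden_ratio: "x / golden_ratio = x * (golden_ratio - 1)"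
proof -
  have "x * (golden_ratio - 1) * golden_ratio = x"
    using golden_ratio_squared by (simp add: algebra_simps flip: mult.assoc)
  then show ?thesis using golden_ratio_pos by (simp add: divide_eq_eq)
qed

lemma sign_pairs:
  "{h s t | s t. s \<in> {-1, 1 :: real} \<and> t \<in> {-1, 1 :: real}} = {h (-1) (-1), h (-1) 1, h 1 (-1), h 1 1}"
  by auto

lemma sign_triples:
  "{h x y z | x y z. x \<in> {-1, 1 :: real} \<and> y \<in> {-1, 1 :: real} \<and> z \<in> {-1, 1 :: real}} =
   {h (-1) (-1) (-1), h (-1) (-1) 1, h (-1) 1 (-1), h (-1) 1 1,
    h 1 (-1) (-1), h 1 (-1) 1, h 1 1 (-1), h 1 1 1}"
  by auto

lemma tetrahedron_iff: "tetrahedron P \<longleftrightarrow> similar_to P (convex hull (point ` set tetrahedron_points))"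
  by (simp add: tetrahedron_def tetrahedron_points_def)

lemma octahedron_iff: "octahedron P \<longleftrightarrow> similar_to P (convex hull (point ` set octahedron_points))"
  by (simp add: octahedron_def octahedron_points_def)

lemma point_cube_points:
  "point ` set cube_points =
     {vector [x, y, z] | x y z. x \<in> {-1, 1} \<and> y \<in> {-1, 1} \<and> z \<in> {-1, 1}}"
  unfolding sign_triples by (simp add: cube_points_def)

lemma cube_iff: "cube P \<longleftrightarrow> similar_to P (convex hull (point ` set cube_points))"
  by (simp only: cube_def point_cube_points)

lemma icosahedron_iff: "icosahedron P \<longleftrightarrow> similar_to P (convex hull (point ` set icosahedron_points))"
  unfolding icosahedron_def sign_pairs by (simp add: icosahedron_points_def insert_commute)

lemma dodecahedron_iff: "dodecahedron P \<longleftrightarrow> similar_to P (convex hull (point ` set dodecahedron_points))"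
  unfolding dodecahedron_def dodecahedron_points_def set_append image_Un point_cube_points sign_pairs
  by (simp add: divide_golden_ratio insert_commute)

lemma tetrahedron_points_span:
  assumes "\<And>p. p \<in> set tetrahedron_points \<Longrightarrow> point p \<bullet> y = 0"
  shows "y = 0"
  using assms[of "(1, 1, 1)"] assms[of "(1, -1, -1)"] assms[of "(-1, 1, -1)"] assms[of "(-1, -1, 1)"]
  by (simp add: tetrahedron_points_def inner_point vec_eq_iff forall_3 del: point.simps)

text \<open>
  The tetrahedron inscribed in the cube, and with it in the dodecahedron, already spans the space.
\<close>

lemma tetrahedron_points_subset_cube_points: "set tetrahedron_points \<subseteq> set cube_points"
  by (simp add: tetrahedron_points_def cube_points_def)

lemma octahedron_points_span:
  assumes "\<And>p. p \<in> set octahedron_points \<Longrightarrow> point p \<bullet> y = 0"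
  shows "y = 0"
  using assms[of "(1, 0, 0)"] assms[of "(0, 1, 0)"] assms[of "(0, 0, 1)"]
  by (simp add: octahedron_points_def inner_point vec_eq_iff forall_3 del: point.simps)

lemma icosahedron_points_span:
  assumes "\<And>p. p \<in> set icosahedron_points \<Longrightarrow> point p \<bullet> y = 0"
  shows "y = 0"
proof -
  have "(0, 1, phi) \<in> set icosahedron_points" "(0, -1, phi) \<in> set icosahedron_points"
    "(1, phi, 0) \<in> set icosahedron_points"
    by code_simp+
  then show ?thesis
    using assms[of "(0, 1, phi)"] assms[of "(0, -1, phi)"] assms[of "(1, phi, 0)"] golden_ratio_pos
    by (simp add: inner_point vec_eq_iff forall_3 del: point.simps)
qed

lemma tetrahedron_metric_data:
  assumes "tetrahedron P" "inscribed_in_sphere P 1"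
  shows "metric_data P 4 6 3 (2 ^ 18 / 3 ^ 6) (2 ^ 3 / 3)"
  by (rule golden_solid_metric_data[OF golden_solid_tetrahedron tetrahedron_points_span,
        where \<kappa> = "(8 / 3) ^ 3"])
    (use assms in \<open>simp_all add: tetrahedron_iff tetrahedron_points_def power_divide\<close>)

lemma octahedron_metric_data:
  assumes "octahedron P" "inscribed_in_sphere P 1"
  shows "metric_data P 6 12 4 (2 ^ 18) (2 ^ 3)"
  by (rule golden_solid_metric_data[OF golden_solid_octahedron octahedron_points_span,
        where \<kappa> = "2 ^ 6"])
    (use assms in \<open>simp_all add: octahedron_iff octahedron_points_def\<close>)

lemma cube_metric_data:
  assumes "cube P" "inscribed_in_sphere P 1"
  shows "metric_data P 8 12 3 (2 ^ 68 / 3 ^ 24) (2 ^ 7 / 3 ^ 2)"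
proof (rule golden_solid_metric_data[OF golden_solid_cube, where \<kappa> = "2 ^ 17 / 3 ^ 6"])
  show "y = 0" if "\<And>p. p \<in> set cube_points \<Longrightarrow> point p \<bullet> y = 0" for y
    using that tetrahedron_points_subset_cube_points by (intro tetrahedron_points_span) auto
  show "length cube_points = 8" by (simp add: cube_points_def)
qed (use assms in \<open>auto simp: cube_iff power_divide\<close>)

text \<open>
  Up to the unit \<open>\<phi>\<close>, the squared circumradius \<open>2 + \<phi>\<close> of the icosahedron is a square root of 5.
  This turns the products of its chords into rational numbers.
\<close>

lemma golden_ratio_plus_2_squared: "(2 + golden_ratio)\<^sup>2 = 5 * golden_ratio\<^sup>2"
  using golden_ratio_squared by (simp add: power2_eq_square algebra_simps)

lemma icosahedron_metric_data:
  assumes "icosahedron P" "inscribed_in_sphere P 1"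
  shows "metric_data P 12 30 5 (2 ^ 132 / 5 ^ 30) (2 ^ 6 / 5)"
proof (rule golden_solid_metric_data[OF golden_solid_icosahedron icosahedron_points_span,
      where \<kappa> = "2 ^ 22 / 5 ^ 5"])
  show "length icosahedron_points = 12" by (simp add: icosahedron_points_def)
  have nz: "golden_ratio \<noteq> 0" "2 + golden_ratio \<noteq> 0" using golden_ratio_pos by linarith+
  have "(2 + golden_ratio) ^ 10 = ((2 + golden_ratio)\<^sup>2) ^ 5" by (simp only: flip: power_mult) simp
  also have "\<dots> = 5 ^ 5 * golden_ratio ^ 10"
    by (simp only: golden_ratio_plus_2_squared power_mult_distrib flip: power_mult) simp
  finally have p10: "(2 + golden_ratio) ^ 10 = 5 ^ 5 * golden_ratio ^ 10" .
  have "(2 + golden_ratio) ^ 11 = (2 + golden_ratio) ^ 10 * (2 + golden_ratio)"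
    by (simp flip: power_Suc2)
  then show "golden_real (2 ^ 22 * phi ^ 10 * (2 + phi)) / golden_real (2 + phi) ^ (12 - 1) = 2 ^ 22 / 5 ^ 5"
    using nz by (simp add: p10)
  have "2 ^ 6 / 5 = 64 * golden_ratio\<^sup>2 / (2 + golden_ratio)\<^sup>2"
    unfolding golden_ratio_plus_2_squared using nz by simp
  also have "\<dots> = (4 / (2 + golden_ratio)) * (4 * (1 + golden_ratio) / (2 + golden_ratio)) * 4"
    using golden_ratio_squared by (simp add: power2_eq_square add.commute)
  also have "\<dots> = (\<Prod>e\<leftarrow>[4, 4 * (1 + phi), 4 * (2 + phi)]. golden_real e / golden_real (2 + phi))"
    using nonzero_mult_div_cancel_right[OF nz(2), of 4] by (simp del: distrib_left_numeral nonzero_mult_div_cancel_right)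
  finally show "2 ^ 6 / 5 = (\<Prod>e\<leftarrow>[4, 4 * (1 + phi), 4 * (2 + phi)]. golden_real e / golden_real (2 + phi))" .
qed (use assms golden_ratio_pos in \<open>auto simp: icosahedron_iff power_divide\<close>)

lemma dodecahedron_metric_data:
  assumes "dodecahedron P" "inscribed_in_sphere P 1"
  shows "metric_data P 20 30 3 (2 ^ 440 / 3 ^ 180) (2 ^ 11 / 3 ^ 4)"
proof (rule golden_solid_metric_data[OF golden_solid_dodecahedron, where \<kappa> = "2 ^ 44 / 3 ^ 18"])
  show "length dodecahedron_points = 20" by (simp add: dodecahedron_points_def cube_points_def)
  show "y = 0" if "\<And>p. p \<in> set dodecahedron_points \<Longrightarrow> point p \<bullet> y = 0" for y
    using that tetrahedron_points_subset_cube_points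
    unfolding dodecahedron_points_def set_append by (intro tetrahedron_points_span) blast
  \<comment> \<open>The two irrational squared distances are conjugate, so their product is an integer.\<close>
  have conj: "(8 - 4 * golden_ratio) * (4 + 4 * golden_ratio) = 16"
    using golden_ratio_squared by (simp add: algebra_simps)
  have "2 ^ 11 / 3 ^ 4 = 16 * (4 * 8 * 12 / 3 ^ 5 :: real)" by simp
  also have "\<dots> = (8 - 4 * golden_ratio) / 3 * (4 / 3 * (8 / 3 * ((4 + 4 * golden_ratio) / 3 * (12 / 3))))"
    unfolding conj[symmetric] by simp
  also have "\<dots> = (\<Prod>e\<leftarrow>[8 - 4 * phi, 4, 8, 4 + 4 * phi, 12]. golden_real e / golden_real 3)"
    by simp
  finally show "2 ^ 11 / 3 ^ 4 = (\<Prod>e\<leftarrow>[8 - 4 * phi, 4, 8, 4 + 4 * phi, 12]. golden_real e / golden_real 3)" .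
  have "1 < golden_ratio" "golden_ratio < 2"
    by (simp_all add: golden_ratio_def real_less_rsqrt real_less_lsqrt)
  then show "0 < golden_real (8 - 4 * phi)"
    "\<And>e. e \<in> set [4, 8, 4 + 4 * phi, 12] \<Longrightarrow> golden_real (8 - 4 * phi) \<le> golden_real e"
    by auto
qed (use assms in \<open>auto simp: dodecahedron_iff power_divide\<close>)

section \<open>Exponents of the chord products\<close>

text \<open>
  Clearing denominators, the powers of 2 on both sides are coprime to those of \<open>p\<close> and therefore
  divide each other.
\<close>

lemma two_power_over_odd_power_unique:
  fixes p a b a' b' :: nat
  assumes "odd p" "1 < p" and eq: "(2::real) ^ a / real p ^ b = 2 ^ a' / real p ^ b'"
  shows "a = a' \<and> b = b'"
proof -
  have nat_eq: "2 ^ a * p ^ b' = 2 ^ a' * p ^ b"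
  proof -
    have "real (2 ^ a * p ^ b') = real (2 ^ a' * p ^ b)"
      using eq assms(2) by (simp add: field_simps)
    then show ?thesis by (simp only: of_nat_eq_iff)
  qed
  have cop: "coprime (2 ^ i) (p ^ j)" for i j using assms(1) by simp
  have "2 ^ a dvd 2 ^ a' * p ^ b" "2 ^ a' dvd 2 ^ a * p ^ b'"
    using nat_eq by (metis dvd_triv_left)+
  then have "(2::nat) ^ a dvd 2 ^ a'" "(2::nat) ^ a' dvd 2 ^ a"
    using cop by (simp_all add: coprime_dvd_mult_left_iff)
  then have "a = a'" by (simp add: dvd_power_iff_le)
  then show ?thesis using nat_eq assms(2) by (auto simp: power_inject_exp)
qed

theorem theorem6p5:
  fixes P :: "(real ^ 3) set" and E V \<nu> \<epsilon> a b :: nat and \<epsilon>' :: real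
  assumes regular: "regular_3_polytope P"
    and inscribed: "inscribed_in_sphere P 1"
    and E: "E = card (edges P)"
    and V: "V = card (vertices P)"
    and nu: "\<And>e. e \<in> edges P \<Longrightarrow> card {v \<in> vertices P. v \<in> e} = \<nu>"
    and eps: "\<And>v. v \<in> vertices P \<Longrightarrow> card {e \<in> edges P. v \<in> e} = \<epsilon>"
    and pos: "0 < a" "0 < b"
    and prod_chords: "(\<Prod>s\<in>chords P. (diameter s)\<^sup>2) = real \<nu> ^ a / real \<epsilon> ^ b"
    and E_dvd_b: "E dvd b"
    and cong_tetrahedron: "tetrahedron P \<Longrightarrow> [a = 0] (mod E) \<and> [a = E] (mod V)"
    and cong_octahedron_cube:
      "octahedron P \<or> cube P \<Longrightarrow> [a = V] (mod E) \<and> [a = E] (mod V)"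
    and cong_icosahedron_dodecahedron:
      "icosahedron P \<or> dodecahedron P \<Longrightarrow> [a = V] (mod E) \<and> [a = 0] (mod V)"
    and eps': "\<epsilon>' = real E / real (gcd E V)"
  shows "(\<exists>c d :: int.
            (\<Prod>l\<in>chord_lengths P. l\<^sup>2) = real \<nu> powi c / real \<epsilon> powi d \<and>
            (tetrahedron P \<longrightarrow> int b = d * int E) \<and>
            (cube P \<or> icosahedron P \<longrightarrow> int b = d * int E) \<and>
            (octahedron P \<longrightarrow> int a = c * int V * 1) \<and>
            (dodecahedron P \<longrightarrow> int a = c * int V * 2)) \<and>
         \<epsilon>' = real (lcm E V) / real V \<and>
         (\<exists>c' d' :: int.
            (\<Prod>l\<in>chord_lengths P. l\<^sup>2) = real \<nu> powi c' / \<epsilon>' powi d' \<and>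
            (tetrahedron P \<or> cube P \<or> icosahedron P \<longrightarrow> int b = d' * int E) \<and>
            (octahedron P \<longrightarrow> int a = c' * int V * 1) \<and>
            (dodecahedron P \<longrightarrow> int a = c' * int V * 2))"
    (is "?first \<and> ?eps' \<and> ?second")
proof -
  \<comment> \<open>The number of vertices tells the five kinds apart, so only one case of the conclusion applies.\<close>
  have V_tetrahedron: "tetrahedron P \<Longrightarrow> V = 4" and V_octahedron: "octahedron P \<Longrightarrow> V = 6"
    and V_cube: "cube P \<Longrightarrow> V = 8" and V_icosahedron: "icosahedron P \<Longrightarrow> V = 12"
    and V_dodecahedron: "dodecahedron P \<Longrightarrow> V = 20"
    using tetrahedron_metric_data octahedron_metric_data cube_metric_data icosahedron_metric_data
      dodecahedron_metric_data inscribed unfolding metric_data_def V by blast+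
  have data: "V = n" "E = m" "\<nu> = 2" "\<epsilon> = k" "2 ^ a / real k ^ b = Q" "(\<Prod>l\<in>chord_lengths P. l\<^sup>2) = q"
    if md: "metric_data P n m k Q q" and "0 < n" "0 < m" for n m k Q q
  proof -
    show "V = n" "E = m" and q: "(\<Prod>l\<in>chord_lengths P. l\<^sup>2) = q"
      using md E V by (simp_all add: metric_data_def)
    then have "edges P \<noteq> {}" "vertices P \<noteq> {}" using that E V by auto
    then obtain e v where e: "e \<in> edges P" and v: "v \<in> vertices P" by auto
    show \<nu>: "\<nu> = 2" and \<epsilon>: "\<epsilon> = k"
      using md nu[OF e] eps[OF v] e v by (auto simp: metric_data_def)
    show "2 ^ a / real k ^ b = Q"
      using md prod_chords by (simp add: metric_data_def \<nu> \<epsilon>)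
  qed
  have gcd_lcm: ?eps' if "0 < V"
  proof -
    have "real (gcd E V) * real (lcm E V) = real E * real V"
      by (metis of_nat_mult prod_gcd_lcm_nat)
    moreover have "real (gcd E V) \<noteq> 0" using that by simp
    ultimately show ?thesis using that by (simp add: eps' field_simps)
  qed
  from regular consider "tetrahedron P" | "octahedron P" | "cube P" | "icosahedron P" | "dodecahedron P"
    unfolding regular_3_polytope_def by blast
  then have "?first \<and> ?second \<and> 0 < V"
  proof cases
    case 1
    note d = data[OF tetrahedron_metric_data[OF 1 inscribed], simplified]
    have "b = 6"
      using two_power_over_odd_power_unique[of 3 a b 18 6] d(5) by simp
    moreover have "\<epsilon>' = 3" using d eps' by (simp add: gcd_non_0_nat)
    moreover have "\<not> octahedron P" "\<not> dodecahedron P" using V_octahedron V_dodecahedron d by auto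
    ultimately show ?thesis
      using d by (intro conjI exI[of _ 3] exI[of _ 1]) auto
  next
    case 2
    note d = data[OF octahedron_metric_data[OF 2 inscribed], simplified]
    \<comment> \<open>Here \<open>\<epsilon> = 4\<close> is a power of \<open>\<nu>\<close>, so the product determines only \<open>a - 2 b\<close>; that \<open>E = 12\<close>
      divides \<open>b\<close> is what makes \<open>a\<close> a multiple of \<open>V = 6\<close>.\<close>
    obtain j where j: "b = 12 * j" using E_dvd_b d by auto
    have "(2::real) ^ a = 2 ^ 18 * 4 ^ b" using d(5) by (simp add: field_simps)
    also have "\<dots> = 2 ^ (18 + 2 * b)" by (simp add: power_add power_mult)
    finally have a: "a = 18 + 24 * j" by (simp add: j del: power_numeral)
    have "\<not> tetrahedron P" "\<not> cube P" "\<not> icosahedron P" "\<not> dodecahedron P"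
      using V_tetrahedron V_cube V_icosahedron V_dodecahedron d by auto
    moreover have "\<epsilon>' = 2" using d eps' by (simp add: gcd_non_0_nat)
    moreover have "(2::real) powi (3 + 4 * int j) / 4 powi (2 * int j) = 8"
      "(2::real) powi (3 + 4 * int j) / 2 powi (4 * int j) = 8"
      by (simp_all add: power_int_add power_int_mult)
    ultimately show ?thesis
      using d a by (intro conjI exI[of _ "3 + 4 * int j"] exI[of _ "2 * int j"] exI[of _ "4 * int j"]) auto
  next
    case 3
    note d = data[OF cube_metric_data[OF 3 inscribed], simplified]
    have "b = 24"
      using two_power_over_odd_power_unique[of 3 a b 68 24] d(5) by simp
    moreover have "\<epsilon>' = 3" using d eps' by (simp add: gcd_non_0_nat)
    moreover have "\<not> octahedron P" "\<not> dodecahedron P" using V_octahedron V_dodecahedron d by auto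
    ultimately show ?thesis
      using d by (intro conjI exI[of _ 7] exI[of _ 2]) auto
  next
    case 4
    note d = data[OF icosahedron_metric_data[OF 4 inscribed], simplified]
    have "b = 30"
      using two_power_over_odd_power_unique[of 5 a b 132 30] d(5) by simp
    moreover have "\<epsilon>' = 5" using d eps' by (simp add: gcd_non_0_nat)
    moreover have "\<not> octahedron P" "\<not> dodecahedron P" using V_octahedron V_dodecahedron d by auto
    ultimately show ?thesis
      using d by (intro conjI exI[of _ 6] exI[of _ 1]) auto
  next
    case 5
    note d = data[OF dodecahedron_metric_data[OF 5 inscribed], simplified]
    have "a = 440"
      using two_power_over_odd_power_unique[of 3 a b 440 180] d(5) by simp
    moreover have "\<epsilon>' = 3" using d eps' by (simp add: gcd_non_0_nat)
    moreover have "\<not> tetrahedron P" "\<not> cube P" "\<not> icosahedron P" "\<not> octahedron P"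
      using V_tetrahedron V_cube V_icosahedron V_octahedron d by auto
    ultimately show ?thesis
      using d by (intro conjI exI[of _ 11] exI[of _ 4]) auto
  qed
  then show ?thesis using gcd_lcm by blast
qed

end
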